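(* There is no $13$-cap of dimension $7$ in $\mathbb{Z}_2^n$ (for any $n$).
   Context: Work in $\mathbb{Z}_2^n$. The dimension of a subset $S$ is the dimension of its affine span $\operatorname{aff}(S)$, the smallest affine flat containing $S$ (equivalently, the set of all sums of an odd number of distinct elements of $S$). A quad is a set of four distinct elements summing to $\mathbf{0}$; a cap is a quad-free subset; a $k$-cap is a cap with $k$ elements. *)

theory Defs
  imports "HOL-Library.Z2" "HOL-Analysis.Cartesian_Space"
begin

text \<open>\<open>\<int>\<^sub>2\<^sup>n\<close> is the type \<^typ>\<open>bit ^ 'n\<close> with \<open>n = CARD('n)\<close>; the prefix \<open>vec\<close> refers to its
  structure as a vector space over the field \<^typ>\<open>bit\<close>.\<close>

definition flat :: "(bit ^ 'n::finite) set \<Rightarrow> bool" where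
  "flat F \<longleftrightarrow> (\<exists>a W. vec.subspace W \<and> F = (\<lambda>w. a + w) ` W)"

definition aff :: "(bit ^ 'n::finite) set \<Rightarrow> (bit ^ 'n) set" where
  "aff S = \<Inter> {F. flat F \<and> S \<subseteq> F}"

text \<open>The dimension of a flat is that of its direction space, the set of differences of its
  points (see \<open>flat_dim_coset\<close>). The empty set gets dimension 0 instead of \<open>-1\<close>.\<close>

definition flat_dim :: "(bit ^ 'n::finite) set \<Rightarrow> nat" where
  "flat_dim F = vec.dim {x - y | x y. x \<in> F \<and> y \<in> F}"

definition affine_dimension :: "(bit ^ 'n::finite) set \<Rightarrow> nat" where
  "affine_dimension S = flat_dim (aff S)"

definition quad :: "(bit ^ 'n::finite) set \<Rightarrow> bool" where
  "quad Q \<longleftrightarrow> card Q = 4 \<and> (\<Sum>x\<in>Q. x) = 0"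

definition cap :: "(bit ^ 'n::finite) set \<Rightarrow> bool" where
  "cap S \<longleftrightarrow> \<not> (\<exists>Q. Q \<subseteq> S \<and> quad Q)"

definition k_cap :: "nat \<Rightarrow> (bit ^ 'n::finite) set \<Rightarrow> bool" where
  "k_cap k S \<longleftrightarrow> cap S \<and> card S = k"

lemma flat_dim_coset:
  assumes "vec.subspace W"
  shows "flat_dim ((\<lambda>w. a + w) ` W) = vec.dim W"
proof -
  have "{x - y | x y. x \<in> (\<lambda>w. a + w) ` W \<and> y \<in> (\<lambda>w. a + w) ` W} = W" (is "?D = W")
  proof (intro equalityI subsetI)
    fix z assume "z \<in> ?D"
    then obtain u v where "u \<in> W" "v \<in> W" "z = (a + u) - (a + v)" by blast
    then show "z \<in> W"
      using vec.subspace_diff[OF assms, of u v] by (simp only: add_diff_cancel_left)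
  next
    fix z assume "z \<in> W"
    moreover have "0 \<in> W" using assms by (rule vec.subspace_0)
    ultimately have "(a + z) - (a + 0) \<in> ?D" by blast
    then show "z \<in> ?D" by (simp only: add_diff_cancel_left diff_zero)
  qed
  then show ?thesis by (simp add: flat_dim_def)
qed

lemma aff_eq_coset:
  assumes "a \<in> S"
  shows "aff S = (\<lambda>w. a + w) ` vec.span ((\<lambda>x. x - a) ` S)" (is "_ = ?R")
proof (intro equalityI subsetI)
  have "x \<in> ?R" if "x \<in> S" for x
  proof
    show "x = a + (x - a)" by simp
    show "x - a \<in> vec.span ((\<lambda>x. x - a) ` S)" using that by (simp add: vec.span_base)
  qed
  moreover have "flat ?R" unfolding flat_def
    by (intro exI conjI) (rule vec.subspace_span refl)+
  ultimately have "?R \<in> {F. flat F \<and> S \<subseteq> F}" by (simp only: mem_Collect_eq subsetI)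
  then show "x \<in> ?R" if "x \<in> aff S" for x
    using that unfolding aff_def by (rule InterD[rotated])
next
  fix x assume "x \<in> ?R"
  then obtain w where w: "w \<in> vec.span ((\<lambda>x. x - a) ` S)" "x = a + w" by blast
  show "x \<in> aff S" unfolding aff_def
  proof clarify
    fix F assume "flat F" "S \<subseteq> F"
    then obtain b W where W: "vec.subspace W" "F = (\<lambda>w. b + w) ` W" unfolding flat_def by blast
    have F: "\<exists>u\<in>W. y = b + u" if "y \<in> S" for y
      using subsetD[OF \<open>S \<subseteq> F\<close> that] unfolding W(2) image_iff .
    obtain v where v: "v \<in> W" "a = b + v" using F[OF assms] by (rule bexE)
    have "y - a \<in> W" if y: "y \<in> S" for y
    proof -
      obtain u where u: "u \<in> W" "y = b + u" using F[OF y] by (rule bexE)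
      show ?thesis
        unfolding u(2) v(2) add_diff_cancel_left by (rule vec.subspace_diff[OF W(1) u(1) v(1)])
    qed
    then have "(\<lambda>x. x - a) ` S \<subseteq> W" by (rule image_subsetI)
    then have "w \<in> W" using w(1) by (rule subsetD[OF vec.span_minimal[OF _ W(1)]])
    have "x = b + (v + w)" by (simp only: w(2) v(2) add.assoc)
    moreover have "v + w \<in> W" using vec.subspace_add[OF W(1) v(1) \<open>w \<in> W\<close>] .
    ultimately show "x \<in> F" unfolding W(2) by (rule image_eqI)
  qed
qed

end

theory Submission imports Defs begin

text \<open>The subsets of even size and zero sum of a 13-cap of dimension 7 form, under symmetric
  difference, a binary linear code of length 13 with 32 words, all of whose weights are even and
  at least 6. The Plotkin bound applied to the words that avoid three given points shows that there
  are at most 6 of them, hence exactly 4, and so the code restricts onto all subsets of any three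
  points. The first three binomial moments of the weight distribution are therefore 1/256 of those of the
  full power set, and they are incompatible with the polynomial \<open>(w - 6) (w - 8) (12 - w)\<close>, which
  is nonnegative at the weights 6, 8, 10 and 12: its sum over the code would be 544, although the
  empty word alone contributes 576.\<close>

section \<open>Families of sets closed under symmetric difference\<close>

abbreviation symdiff :: "'a set \<Rightarrow> 'a set \<Rightarrow> 'a set" where
  "symdiff A B \<equiv> (A - B) \<union> (B - A)"

lemma symdiff_symdiff_cancel: "symdiff A (symdiff A B) = B"
  by blast

text \<open>The fibres of \<open>h\<close> are cosets of \<open>K\<close>. Translation by a fixed
  \<open>A\<close> is an involution, so it serves as its own inverse in matching the fibre through
  \<open>A\<close> with \<open>K\<close>.\<close>

lemma symdiff_fibre_card:
  assumes closed: "\<And>A B. A \<in> G \<Longrightarrow> B \<in> G \<Longrightarrow> symdiff A B \<in> G"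
    and h: "\<And>A B. A \<in> G \<Longrightarrow> B \<in> G \<Longrightarrow> h A = h B \<longleftrightarrow> symdiff A B \<in> K"
    and "K \<subseteq> G" "y \<in> h ` G"
  shows "card {A \<in> G. h A = y} = card K"
proof -
  obtain A where A: "A \<in> G" "y = h A" using assms(4) by blast
  have "bij_betw (symdiff A) {B \<in> G. h B = y} K"
  proof (rule bij_betw_byWitness[where f' = "symdiff A"])
    show "symdiff A ` {B \<in> G. h B = y} \<subseteq> K"
    proof (rule image_subsetI)
      fix B assume "B \<in> {B \<in> G. h B = y}"
      then show "symdiff A B \<in> K" using h[of A B] A by simp
    qed
    show "symdiff A ` K \<subseteq> {B \<in> G. h B = y}"
    proof (rule image_subsetI)
      fix B assume B: "B \<in> K"
      then have "B \<in> G" using \<open>K \<subseteq> G\<close> by blast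
      then have "symdiff A B \<in> G" using closed A by blast
      moreover have "h A = h (symdiff A B)"
        using h[OF A(1) calculation] B unfolding symdiff_symdiff_cancel by blast
      ultimately show "symdiff A B \<in> {B \<in> G. h B = y}" using A(2) by auto
    qed
  qed (auto simp only: symdiff_symdiff_cancel)
  then show ?thesis by (rule bij_betw_same_card)
qed

text \<open>Lagrange's theorem for a group under symmetric difference. It is applied below to three
  maps: the parity of the size, the restriction to a set of points, and the sum of the
  elements.\<close>

lemma symdiff_card_image_kernel:
  assumes "finite G"
    and "\<And>A B. A \<in> G \<Longrightarrow> B \<in> G \<Longrightarrow> symdiff A B \<in> G"
    and "\<And>A B. A \<in> G \<Longrightarrow> B \<in> G \<Longrightarrow> h A = h B \<longleftrightarrow> symdiff A B \<in> K"
    and "K \<subseteq> G"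
  shows "card G = card (h ` G) * card K"
proof -
  have "card G = (\<Sum>y\<in>h ` G. \<Sum>A\<in>{A \<in> G. h A = y}. 1)"
    using sum.image_gen[OF assms(1), of "\<lambda>_. 1::nat" h] by simp
  also have "\<dots> = (\<Sum>y\<in>h ` G. card K)"
    using symdiff_fibre_card[OF assms(2,3,4)] by (intro sum.cong) auto
  finally show ?thesis by simp
qed

lemma even_card_symdiff:
  assumes "finite A" "finite B"
  shows "even (card (symdiff A B)) \<longleftrightarrow> (even (card A) \<longleftrightarrow> even (card B))"
proof -
  have "card (symdiff A B) = card (A - B) + card (B - A)"
    using assms by (intro card_Un_disjoint) auto
  moreover have "card A = card (A - B) + card (A \<inter> B)"
    using card_Int_Diff[OF assms(1), of B] by simp
  moreover have "card B = card (B - A) + card (A \<inter> B)"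
    using card_Int_Diff[OF assms(2), of A] by (simp add: Int_commute)
  ultimately show ?thesis by auto
qed

text \<open>The parity map on \<open>Pow S\<close> takes both values because \<open>S\<close> is
  nonempty, and its kernel consists of the even subsets.\<close>

lemma card_even_subsets:
  assumes "finite S" "S \<noteq> {}"
  shows "2 * card {A. A \<subseteq> S \<and> even (card A)} = 2 ^ card S"
proof -
  obtain a where a: "a \<in> S" using assms(2) by blast
  have "(\<lambda>A. even (card A)) ` Pow S = UNIV"
  proof -
    have "True \<in> (\<lambda>A. even (card A)) ` Pow S"
      by (rule image_eqI[of _ _ "{}"]) simp_all
    moreover have "False \<in> (\<lambda>A. even (card A)) ` Pow S"
      using a by (intro image_eqI[of _ _ "{a}"]) simp_all
    ultimately show ?thesis by (auto simp: UNIV_bool)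
  qed
  moreover have "card (Pow S) =
      card ((\<lambda>A. even (card A)) ` Pow S) * card {A. A \<subseteq> S \<and> even (card A)}"
  proof (rule symdiff_card_image_kernel)
    fix A B assume "A \<in> Pow S" "B \<in> Pow S"
    then have "finite A" "finite B" "symdiff A B \<subseteq> S"
      using assms(1) by (auto intro: finite_subset)
    then show "even (card A) = even (card B) \<longleftrightarrow> symdiff A B \<in> {A. A \<subseteq> S \<and> even (card A)}"
      using even_card_symdiff[of A B] by simp
  qed (use assms in auto)
  ultimately show ?thesis using assms(1) by (simp add: card_Pow)
qed

text \<open>Double counting of the pairs \<open>U \<subseteq> T\<close> with \<open>T\<close> in
  \<open>C\<close> and \<open>U\<close> of size \<open>k\<close>.\<close>

lemma sum_card_choose:
  assumes "finite S" "finite C" "C \<subseteq> Pow S"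
  shows "(\<Sum>T\<in>C. card T choose k) = (\<Sum>U | U \<subseteq> S \<and> card U = k. card {T \<in> C. U \<subseteq> T})"
proof -
  have "(\<Sum>T\<in>C. card T choose k) = (\<Sum>T\<in>C. \<Sum>U | U \<in> {U. U \<subseteq> S \<and> card U = k} \<and> U \<subseteq> T. 1)"
  proof (rule sum.cong[OF refl])
    fix T assume "T \<in> C"
    then have "T \<subseteq> S" using assms(3) by blast
    moreover have "finite T" using calculation assms(1) by (rule finite_subset)
    moreover have "{U. U \<in> {U. U \<subseteq> S \<and> card U = k} \<and> U \<subseteq> T} = {U. U \<subseteq> T \<and> card U = k}"
      using \<open>T \<subseteq> S\<close> by blast
    ultimately show "card T choose k = (\<Sum>U | U \<in> {U. U \<subseteq> S \<and> card U = k} \<and> U \<subseteq> T. 1)"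
      using n_subsets[of T k] by simp
  qed
  also have "\<dots> = (\<Sum>U | U \<subseteq> S \<and> card U = k. \<Sum>T | T \<in> C \<and> U \<subseteq> T. 1)"
    using assms by (intro sum.swap_restrict) auto
  finally show ?thesis by simp
qed

section \<open>Binary linear codes\<close>

text \<open>If some member \<open>A\<close> contains \<open>p\<close>, translation by
  \<open>A\<close> injects the members containing \<open>p\<close> into those that avoid it.\<close>

lemma symdiff_half_contain:
  assumes "finite D" "\<And>A B. A \<in> D \<Longrightarrow> B \<in> D \<Longrightarrow> symdiff A B \<in> D"
  shows "2 * card {T \<in> D. p \<in> T} \<le> card D"
proof (cases "\<exists>A\<in>D. p \<in> A")
  case True
  then obtain A where A: "A \<in> D" "p \<in> A" by blast
  have "inj_on (symdiff A) {T \<in> D. p \<in> T}"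
    by (rule inj_on_inverseI[where g = "symdiff A"]) (rule symdiff_symdiff_cancel)
  moreover have "symdiff A ` {T \<in> D. p \<in> T} \<subseteq> {T \<in> D. p \<notin> T}"
    using assms(2)[OF A(1)] A(2) by auto
  ultimately have "card {T \<in> D. p \<in> T} \<le> card {T \<in> D. p \<notin> T}"
    using assms(1) by (intro card_inj_on_le) auto
  moreover have "card D = card {T \<in> D. p \<in> T} + card {T \<in> D. p \<notin> T}"
  proof -
    have "D = {T \<in> D. p \<in> T} \<union> {T \<in> D. p \<notin> T}" by blast
    then show ?thesis using assms(1) by (metis (no_types, lifting) card_Un_disjoint
      disjoint_iff finite_Un mem_Collect_eq)
  qed
  ultimately show ?thesis by simp
next
  case False
  then have "{T \<in> D. p \<in> T} = {}" by blast
  then show ?thesis by (simp only: card.empty mult_0_right le0)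
qed

text \<open>Count the incidences between points and words: each nonempty word contributes at least
  \<open>d\<close>, and each point lies in at most half of the words.\<close>

lemma plotkin_bound:
  assumes "finite P" "D \<subseteq> Pow P" "\<And>A B. A \<in> D \<Longrightarrow> B \<in> D \<Longrightarrow> symdiff A B \<in> D"
    and weight: "\<And>T. T \<in> D \<Longrightarrow> T \<noteq> {} \<Longrightarrow> d \<le> card T"
  shows "2 * d * (card D - 1) \<le> card P * card D"
proof -
  have fin: "finite D" using assms(1,2) finite_subset by auto
  \<comment> \<open>An inequality, since removing \<open>{}\<close> changes \<open>D\<close> only if
    \<open>{}\<close> belongs to it.\<close>
  have "d * (card D - 1) \<le> d * card (D - {{}})"
    by (simp add: card_Diff_singleton_if)
  also have "\<dots> \<le> (\<Sum>T\<in>D - {{}}. card T)"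
    using sum_mono[of "D - {{}}" "\<lambda>_. d" card] weight by (simp add: mult.commute)
  also have "\<dots> \<le> (\<Sum>T\<in>D. card T)"
    using fin by (intro sum_mono2) auto
  also have "\<dots> = (\<Sum>T\<in>D. \<Sum>p | p \<in> P \<and> p \<in> T. 1)"
  proof (rule sum.cong[OF refl])
    fix T assume "T \<in> D"
    then have "{p. p \<in> P \<and> p \<in> T} = T" using assms(2) by blast
    then show "card T = (\<Sum>p | p \<in> P \<and> p \<in> T. 1)" by simp
  qed
  also have "\<dots> = (\<Sum>p\<in>P. card {T \<in> D. p \<in> T})"
    using fin assms(1) by (subst sum.swap_restrict) auto
  finally have "2 * d * (card D - 1) \<le> (\<Sum>p\<in>P. 2 * card {T \<in> D. p \<in> T})"
    by (simp add: sum_distrib_left[symmetric])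
  also have "\<dots> \<le> (\<Sum>p\<in>P. card D)"
    using fin assms(3) by (intro sum_mono symdiff_half_contain) auto
  finally show ?thesis by simp
qed

lemma restriction_kernel:
  assumes "\<And>A B. A \<in> C \<Longrightarrow> B \<in> C \<Longrightarrow> symdiff A B \<in> C" "A \<in> C" "B \<in> C"
  shows "A \<inter> U = B \<inter> U \<longleftrightarrow> symdiff A B \<in> {T \<in> C. T \<inter> U = {}}"
  using assms(1)[OF assms(2,3)] by blast

lemma card_code_restrict:
  assumes "finite C" "\<And>A B. A \<in> C \<Longrightarrow> B \<in> C \<Longrightarrow> symdiff A B \<in> C"
  shows "card C = card ((\<lambda>T. T \<inter> U) ` C) * card {T \<in> C. T \<inter> U = {}}"
  using assms(1,2) restriction_kernel[OF assms(2)] by (rule symdiff_card_image_kernel) auto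

text \<open>The words containing \<open>U\<close> form the fibre over \<open>U\<close> of the
  restriction map, and all \<open>2 ^ card U\<close> fibres have equal size.\<close>

lemma card_code_containing:
  assumes "finite C" "\<And>A B. A \<in> C \<Longrightarrow> B \<in> C \<Longrightarrow> symdiff A B \<in> C"
    and "finite U" "(\<lambda>T. T \<inter> U) ` C = Pow U"
  shows "card C = 2 ^ card U * card {T \<in> C. U \<subseteq> T}"
proof -
  have "U \<in> (\<lambda>T. T \<inter> U) ` C" using assms(4) by blast
  then have "card {T \<in> C. T \<inter> U = U} = card {T \<in> C. T \<inter> U = {}}"
    using symdiff_fibre_card[OF assms(2) restriction_kernel[OF assms(2)]] by blast
  moreover have "{T \<in> C. T \<inter> U = U} = {T \<in> C. U \<subseteq> T}" by blast
  ultimately show ?thesis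
    using card_code_restrict[OF assms(1,2), of U] assms(3,4) by (simp add: card_Pow)
qed

text \<open>\<open>N\<close> will count the words avoiding three points, \<open>a\<close> their
  complementary factor, the restrictions to these points, and \<open>b\<close> the subset sums.
  Divisibility leaves 1, 2 and 4 for \<open>N\<close>; the bounds on \<open>a\<close> and
  \<open>b\<close> exclude 1 and 2, and then \<open>a * b = 1024\<close> forces \<open>a\<close> up
  to 8.\<close>

lemma le_6_factor_of_4096:
  fixes N :: nat
  assumes "N * a * b = 4096" "N \<le> 6" "a \<le> 8" "b \<le> 128"
  shows "N = 4 \<and> a = 8"
proof -
  have "N dvd 4096" by (metis assms(1) dvd_triv_left mult.assoc)
  moreover have "N \<in> {0,1,2,3,4,5,6}" using assms(2) by auto
  ultimately have N: "N \<in> {1,2,4}" by auto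
  have "N * a * b \<le> N * 8 * 128" using assms(3,4) by (intro mult_mono) auto
  then have "N = 4" using N assms(1) by auto
  moreover have "a * b = 1024" using calculation assms(1) by simp
  moreover have "a * b \<le> a * 128" by (rule mult_le_mono2[OF assms(4)])
  ultimately show ?thesis using assms(3) by linarith
qed

lemma binomials:
  "6 choose 2 = (15::nat)" "8 choose 2 = (28::nat)" "10 choose 2 = (45::nat)"
  "12 choose 2 = (66::nat)" "13 choose 2 = (78::nat)"
  "6 choose 3 = (20::nat)" "8 choose 3 = (56::nat)" "10 choose 3 = (120::nat)"
  "12 choose 3 = (220::nat)" "13 choose 3 = (286::nat)"
  by code_simp+

text \<open>The number 4096 counts the even subsets of 13 points, and \<open>m\<close> is the index
  of \<open>C\<close> among them. Thus \<open>m \<le> 128\<close> says that \<open>C\<close> has at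
  least 32 words; the Plotkin bound supplies the opposite inequality.\<close>

lemma no_even_13_5_6_code:
  assumes S: "finite S" "card S = 13" and C: "C \<subseteq> Pow S" "{} \<in> C"
    and closed: "\<And>A B. A \<in> C \<Longrightarrow> B \<in> C \<Longrightarrow> symdiff A B \<in> C"
    and size: "card C * m = 4096" "m \<le> 128"
    and weight: "\<And>T. T \<in> C \<Longrightarrow> T \<noteq> {} \<Longrightarrow> even (card T) \<and> 6 \<le> card T"
  shows False
proof -
  have fin: "finite C" using S C finite_subset by auto
  have triple: "card C = 32 \<and> (\<lambda>T. T \<inter> V) ` C = Pow V" if V: "V \<subseteq> S" "card V = 3" for V
  proof -
    let ?D = "{T \<in> C. T \<inter> V = {}}"
    have finV: "finite V" using V S finite_subset by blast
    \<comment> \<open>The words avoiding \<open>V\<close> form a code on the other ten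
      points.\<close>
    have "2 * 6 * (card ?D - 1) \<le> card (S - V) * card ?D"
      by (rule plotkin_bound) (use S C closed weight in auto)
    moreover have "card (S - V) = 10"
      using V S finV by (simp add: card_Diff_subset)
    ultimately have "12 * (card ?D - 1) \<le> 10 * card ?D" by simp
    then have "card ?D \<le> 6" by linarith
    moreover have sub: "(\<lambda>T. T \<inter> V) ` C \<subseteq> Pow V" by blast
    have "card ((\<lambda>T. T \<inter> V) ` C) \<le> card (Pow V)"
      using sub finV by (intro card_mono) auto
    then have "card ((\<lambda>T. T \<inter> V) ` C) \<le> 8" using V finV by (simp add: card_Pow)
    moreover have restr: "card C = card ((\<lambda>T. T \<inter> V) ` C) * card ?D"
      using card_code_restrict[OF fin closed] by blast
    moreover have "card ?D * card ((\<lambda>T. T \<inter> V) ` C) * m = 4096"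
      using size(1) restr by (simp only: mult.commute)
    ultimately have "card ?D = 4" "card ((\<lambda>T. T \<inter> V) ` C) = 8"
      using le_6_factor_of_4096 size(2) by blast+
    moreover have "(\<lambda>T. T \<inter> V) ` C = Pow V"
      using sub finV V calculation(2) by (intro card_subset_eq) (auto simp: card_Pow)
    ultimately show ?thesis using restr by simp
  qed
  obtain V where "V \<subseteq> S" "card V = 3" using obtain_subset_with_card_n[of 3 S] S by auto
  then have card_C: "card C = 32" using triple by blast
  \<comment> \<open>Extend \<open>U\<close> to a triple \<open>V\<close> and restrict in two stages:
    \<open>C\<close> maps onto \<open>Pow V\<close>, which maps onto \<open>Pow U\<close>.\<close>
  have small: "32 = 2 ^ k * card {T \<in> C. U \<subseteq> T}" if U: "U \<subseteq> S" "card U = k" "k \<le> 3" for U k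
  proof -
    have finU: "finite U" using U S finite_subset by blast
    obtain V where V: "U \<subseteq> V" "V \<subseteq> S" "card V = 3"
      using exists_subset_between[of U 3 S] U S by auto
    have "(\<lambda>T. T \<inter> U) ` C = (\<lambda>T. T \<inter> U) ` (\<lambda>T. T \<inter> V) ` C"
      using V(1) by (auto simp: image_image Int_assoc Int_absorb1)
    also have "\<dots> = (\<lambda>T. T \<inter> U) ` Pow V" using triple V by simp
    also have "\<dots> = Pow U" using V(1) by (auto simp: image_iff)
    finally show ?thesis
      using card_code_containing[OF fin closed finU] card_C U by simp
  qed
  have moment: "2 ^ k * (\<Sum>T\<in>C. card T choose k) = 32 * (13 choose k)" if "k \<le> 3" for k
  proof -
    have "2 ^ k * (\<Sum>T\<in>C. card T choose k)
        = (\<Sum>U | U \<subseteq> S \<and> card U = k. 2 ^ k * card {T \<in> C. U \<subseteq> T})"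
      using sum_card_choose[OF S(1) fin C(1)] by (simp add: sum_distrib_left)
    also have "\<dots> = (\<Sum>U | U \<subseteq> S \<and> card U = k. 32)"
      using small that by (intro sum.cong) auto
    finally show ?thesis using n_subsets[OF S(1), of k] S(2) by simp
  qed
  \<comment> \<open>The empty word is set aside because its weight 0 is outside the range 6 to 12;
    it contributes nothing to the moments with \<open>k\<close> positive.\<close>
  define M where "M k = (\<Sum>T\<in>C - {{}}. card T choose k)" for k
  have M: "(\<Sum>T\<in>C. card T choose k) = (0 choose k) + M k" for k
    unfolding M_def using sum.remove[OF fin C(2), of "\<lambda>T. card T choose k"] by simp
  have "M 1 = 208" "M 2 = 624" "M 3 = 1144"
    using moment[of 1] moment[of 2] moment[of 3] unfolding M
    by (simp_all add: binomials binomial_eq_0)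
  \<comment> \<open>In the binomial basis, \<open>(w - 6) (w - 8) (12 - w)\<close> is 576 - 191
    \<open>(w choose 1)\<close> + 46 \<open>(w choose 2)\<close> - 6 \<open>(w choose 3)\<close>.
    The negative terms are moved to the left to stay within the naturals. With the moments above
    this would read 46592 \<le> 46560.\<close>
  moreover have "6 * M 3 + 191 * M 1 \<le> (\<Sum>T\<in>C - {{}}. 576) + 46 * M 2"
    unfolding M_def sum_distrib_left sum.distrib[symmetric]
  proof (rule sum_mono)
    fix T assume T: "T \<in> C - {{}}"
    then have "card T \<le> 13" using C(1) S card_mono by (metis DiffD1 PowD subsetD)
    moreover have "even (card T)" "6 \<le> card T" using weight[of T] T by auto
    moreover have "n = 6 \<or> n = 8 \<or> n = 10 \<or> n = 12" if "n \<le> 13" "even n" "6 \<le> n" for n :: nat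
      using that by presburger
    ultimately have "card T \<in> {6,8,10,12}" by blast
    then show "6 * (card T choose 3) + 191 * (card T choose 1) \<le> 576 + 46 * (card T choose 2)"
      by (auto simp: binomials)
  qed
  moreover have "(\<Sum>T\<in>C - {{}}. 576) = (17856 :: nat)"
    using fin C(2) card_C by simp
  ultimately show False by simp
qed

section \<open>The code of even zero-sum subsets\<close>

lemma bit_vec_add_self: "x + x = (0 :: bit ^ 'n::finite)"
  by (simp add: vec_eq_iff)

lemma bit_vec_diff_eq_add: "x - y = x + (y :: bit ^ 'n::finite)"
  by (simp add: vec_eq_iff)

lemma sum_symdiff_bit_vec:
  fixes A B :: "(bit ^ 'n::finite) set"
  assumes "finite A" "finite B"
  shows "\<Sum>(symdiff A B) = \<Sum>A + \<Sum>B"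
proof -
  have "\<Sum>(symdiff A B) = \<Sum>(A - B) + \<Sum>(B - A)"
    using assms by (intro sum.union_disjoint) auto
  moreover have "\<Sum>A = \<Sum>(A \<inter> B) + \<Sum>(A - B)" "\<Sum>B = \<Sum>(A \<inter> B) + \<Sum>(B - A)"
    using sum.Int_Diff[OF assms(1), of "\<lambda>x. x" B] sum.Int_Diff[OF assms(2), of "\<lambda>x. x" A]
    by (simp_all add: Int_commute)
  moreover have "u + v + (u + w) = v + w" for u v w :: "bit ^ 'n"
  proof -
    have "u + v + (u + w) = (u + u) + (v + w)" by (simp only: ac_simps)
    then show ?thesis by (simp only: bit_vec_add_self add_0)
  qed
  ultimately show ?thesis by simp
qed

text \<open>Coefficients in \<open>bit\<close> are 0 or 1, so each vector of \<open>W\<close> is the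
  sum of a subset of a basis.\<close>

lemma card_bit_subspace_le:
  fixes W :: "(bit ^ 'n::finite) set"
  assumes "vec.subspace W"
  shows "finite W \<and> card W \<le> 2 ^ vec.dim W"
proof -
  obtain B where B: "B \<subseteq> W" "vec.independent B" "W \<subseteq> vec.span B" "card B = vec.dim W"
    using vec.basis_exists by blast
  have fin: "finite B" using B(2) vec.finiteI_independent by blast
  have "W \<subseteq> (\<lambda>A. \<Sum>A) ` Pow B"
  proof
    fix x assume "x \<in> W"
    then obtain u where u: "x = (\<Sum>v\<in>B. u v *s v)"
      using B(3) vec.span_finite[OF fin] by auto
    have "(\<Sum>v\<in>B. u v *s v) = (\<Sum>v\<in>B. if u v = 1 then v else 0)"
      by (rule sum.cong) auto
    also have "\<dots> = \<Sum>{v \<in> B. u v = 1}" using fin by (simp add: sum.inter_filter)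
    finally show "x \<in> (\<lambda>A. \<Sum>A) ` Pow B" using u by blast
  qed
  then have "card W \<le> card ((\<lambda>A. \<Sum>A) ` Pow B)" "finite W"
    using fin by (auto intro: card_mono finite_subset)
  moreover have "card ((\<lambda>A. \<Sum>A) ` Pow B) \<le> card (Pow B)" using fin by (intro card_image_le) simp
  ultimately show ?thesis using fin B(4) by (simp add: card_Pow)
qed

text \<open>An even number of copies of \<open>a\<close> cancels in characteristic 2, so the sum
  equals a sum of differences \<open>x - a\<close>.\<close>

lemma even_sum_in_direction_space:
  fixes S :: "(bit ^ 'n::finite) set"
  assumes "finite A" "A \<subseteq> S" "even (card A)"
  shows "\<Sum>A \<in> vec.span ((\<lambda>x. x - a) ` S)"
proof -
  have "(\<Sum>x\<in>A. a) = 0"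
  proof -
    obtain k where "card A = 2 * k" using assms(3) by blast
    then show ?thesis by (simp add: vec_eq_iff)
  qed
  then have "\<Sum>A = (\<Sum>x\<in>A. x - a)" by (simp add: sum_subtractf)
  also have "\<dots> \<in> vec.span ((\<lambda>x. x - a) ` S)"
    using assms(2) by (intro vec.span_sum vec.span_base) auto
  finally show ?thesis .
qed

theorem theorem8p2:
  "\<not> (\<exists>S :: (bit ^ 'n::finite) set. k_cap 13 S \<and> affine_dimension S = 7)"
proof
  assume "\<exists>S :: (bit ^ 'n) set. k_cap 13 S \<and> affine_dimension S = 7"
  then obtain S :: "(bit ^ 'n) set" where
    cap: "cap S" and card_S: "card S = 13" and dim: "affine_dimension S = 7"
    unfolding k_cap_def by blast
  have fin: "finite S" using card_S card.infinite by fastforce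
  obtain a where a: "a \<in> S" using card_S by fastforce
  define W where "W = vec.span ((\<lambda>x. x - a) ` S)"
  have W: "vec.subspace W" unfolding W_def by (rule vec.subspace_span)
  have "vec.dim W = 7"
    using dim flat_dim_coset[OF W, of a] aff_eq_coset[OF a]
    unfolding affine_dimension_def W_def by simp
  then have card_W: "finite W" "card W \<le> 128"
    using card_bit_subspace_le[OF W] by auto
  define E where "E = {A. A \<subseteq> S \<and> even (card A)}"
  define C where "C = {A \<in> E. \<Sum>A = 0}"
  have finE: "finite A" if "A \<in> E" for A
    using that fin finite_subset unfolding E_def by blast
  have E_closed: "symdiff A B \<in> E" if "A \<in> E" "B \<in> E" for A B
    using that even_card_symdiff[OF finE finE, OF that] unfolding E_def by blast
  have sum_eq_iff: "\<Sum>A = \<Sum>B \<longleftrightarrow> symdiff A B \<in> C" if "A \<in> E" "B \<in> E" for A B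
  proof -
    have "\<Sum>A = \<Sum>B \<longleftrightarrow> \<Sum>(symdiff A B) = 0"
      unfolding sum_symdiff_bit_vec[OF finE finE, OF that] bit_vec_diff_eq_add[symmetric]
      by (rule right_minus_eq[symmetric])
    then show ?thesis using E_closed[OF that] unfolding C_def by blast
  qed
  have C_closed: "symdiff A B \<in> C" if "A \<in> C" "B \<in> C" for A B
    using that sum_eq_iff[of A B] unfolding C_def by simp
  \<comment> \<open>Summation is a homomorphism on \<open>E\<close> with kernel \<open>C\<close>,
    and its values lie in the direction space \<open>W\<close>, which has at most
    \<open>2 ^ 7\<close> elements.\<close>
  have "card E = card ((\<lambda>A. \<Sum>A) ` E) * card C"
    by (rule symdiff_card_image_kernel)
      (use fin E_closed sum_eq_iff in \<open>auto simp: E_def C_def\<close>)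
  moreover have "card E = 4096"
    using card_even_subsets[OF fin] a card_S unfolding E_def by auto
  ultimately have "card C * card ((\<lambda>A. \<Sum>A) ` E) = 4096" by (simp only: mult.commute)
  moreover have "card ((\<lambda>A. \<Sum>A) ` E) \<le> 128"
  proof -
    have "(\<lambda>A. \<Sum>A) ` E \<subseteq> W"
      using even_sum_in_direction_space finE unfolding W_def E_def by blast
    then show ?thesis using card_mono card_W le_trans by blast
  qed
  \<comment> \<open>Two distinct points cannot sum to zero, and four that do form a quad; the cap
    property thus becomes minimum weight 6.\<close>
  moreover have "even (card T) \<and> 6 \<le> card T" if T: "T \<in> C" "T \<noteq> {}" for T
  proof -
    have T': "T \<subseteq> S" "even (card T)" "\<Sum>T = 0"
      using T(1) unfolding C_def E_def by blast+
    have "finite T" using T'(1) fin by (rule finite_subset)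
    then have "card T \<noteq> 0" using T(2) by (simp only: card_0_eq not_False_eq_True)
    moreover have "card T \<noteq> 2"
    proof
      assume "card T = 2"
      then obtain x y where "T = {x, y}" "x \<noteq> y" by (auto simp: card_2_iff)
      then have "x - y = 0" using T'(3) by (simp add: bit_vec_diff_eq_add)
      then show False using \<open>x \<noteq> y\<close> by (simp only: right_minus_eq)
    qed
    moreover have "card T \<noteq> 4" using cap T' unfolding cap_def quad_def by blast
    moreover have "card T \<noteq> 1" "card T \<noteq> 3" "card T \<noteq> 5" using T'(2) by auto
    ultimately show ?thesis using T'(2) by linarith
  qed
  moreover have "C \<subseteq> Pow S" "{} \<in> C" unfolding C_def E_def by auto
  ultimately show False
    using no_even_13_5_6_code[OF fin card_S] C_closed by blast
qed

end
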